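(* Let $q$ be an odd power of an odd prime and let $r\ge1$ be an integer. If there is a $\mu\in\mathbb{F}_q$ such that $x^{2r+1}-\mu$ is irreducible in $\mathbb{F}_q[x]$, then \[ \chi(ER_{q^{2r+1}})\le \frac{2r+5}{3}\,q^{\frac{4r}{3}+1}+(2r+1)q^{r+1}+1. \]
   Context: For a prime power $Q$, $ER_Q$ is the graph whose vertices are the points of $PG(2,Q)$, i.e. the $1$-dimensional subspaces of $\mathbb{F}_Q^3$, where distinct vertices $(x_0,x_1,x_2)$ and $(y_0,y_1,y_2)$ (homogeneous coordinates) are adjacent if and only if $x_0y_0+x_1y_1+x_2y_2=0$. $\chi$ denotes the chromatic number. *)

theory Defs
  imports "HOL-Computational_Algebra.Polynomial" "HOL-Computational_Algebra.Primes" Complex_Main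
begin

text \<open>Points of PG(2,Q): the 1-dimensional subspaces of F^3, each represented as the set
  of its nonzero vectors (a nonzero vector together with all its nonzero scalar multiples).\<close>
definition proj_points :: "('a::field \<times> 'a \<times> 'a) set set" where
  "proj_points = { {(c * x, c * y, c * z) | c. c \<noteq> 0} | x y z. (x, y, z) \<noteq> (0, 0, 0)}"

text \<open>Adjacency in ER_Q: distinct points whose (homogeneous) coordinates are orthogonal.
  Orthogonality does not depend on the chosen representatives.\<close>
definition er_adj :: "('a::field \<times> 'a \<times> 'a) set \<Rightarrow> ('a \<times> 'a \<times> 'a) set \<Rightarrow> bool" where
  "er_adj P R \<longleftrightarrow> P \<noteq> R \<and>
     (\<exists>x0 x1 x2 y0 y1 y2. (x0, x1, x2) \<in> P \<and> (y0, y1, y2) \<in> R \<and>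
        x0 * y0 + x1 * y1 + x2 * y2 = 0)"

definition proper_colouring :: "'v set \<Rightarrow> ('v \<Rightarrow> 'v \<Rightarrow> bool) \<Rightarrow> nat \<Rightarrow> ('v \<Rightarrow> nat) \<Rightarrow> bool" where
  "proper_colouring V E k f \<longleftrightarrow>
     (\<forall>v\<in>V. f v < k) \<and> (\<forall>u\<in>V. \<forall>v\<in>V. E u v \<longrightarrow> f u \<noteq> f v)"

definition chromatic_number :: "'v set \<Rightarrow> ('v \<Rightarrow> 'v \<Rightarrow> bool) \<Rightarrow> nat" where
  "chromatic_number V E = (LEAST k. \<exists>f. proper_colouring V E k f)"

definition chi_ER :: "'a::{field,finite} itself \<Rightarrow> nat" where
  "chi_ER _ = chromatic_number (proj_points :: ('a \<times> 'a \<times> 'a) set set) er_adj"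

end

theory Submission
  imports Defs "HOL-Number_Theory.Cong"
begin

text \<open>
  Write \<open>F\<close> for the field of order \<open>q\<^bsup>2r+1\<^esup> = p\<^sup>N\<close>. As \<open>-1\<close> is a sum of two squares,
  the quadratic form is isometric to a hyperbolic plane plus a line, and off one line
  of the plane the points can be given coordinates \<open>(x, z) \<in> F\<^sup>2\<close> in which adjacency becomes
  \<open>z + z' + (x - x')\<^sup>2 = 0\<close>.

  Choose \<open>\<theta> \<in> F\<close> with \<open>1, \<dots>, \<theta>\<^bsup>n-1\<^esup>\<close> independent over the prime field, and let \<open>A\<close> and \<open>W\<close> be
  the spans of \<open>\<theta>\<^sup>i\<close> for \<open>i < n\<close> and \<open>i < 2n - 1\<close>, so that squares of elements of \<open>A\<close> lie in \<open>W\<close>.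
  If \<open>z \<notin> W\<close>, colour \<open>(x, z)\<close> by the coset \<open>x + A\<close> together with a sign of \<open>z\<close> that is odd on \<open>F/W\<close>:
  adjacent points with \<open>x - x' \<in> A\<close> have \<open>z + z' \<in> W\<close>, hence opposite signs. The points with \<open>z \<in> W\<close>
  induce a graph of degree at most \<open>#{u. u\<^sup>2 \<in> W} \<le> 2 |W|\<close>, which is coloured greedily. On the
  exceptional line one more colour suffices. The total is \<open>2 p\<^bsup>N-n\<^esup> + 2 p\<^bsup>2n-1\<^esup> + 2\<close>, and
  \<open>n = \<lceil>N/3\<rceil>\<close> balances the two powers.
\<close>

section \<open>Colourings of finite graphs\<close>

lemma chromatic_number_le_card_colours:
  assumes "finite C" "f ` V \<subseteq> C"
    and proper: "\<And>u v. u \<in> V \<Longrightarrow> v \<in> V \<Longrightarrow> E u v \<Longrightarrow> f u \<noteq> f v"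
  shows "chromatic_number V E \<le> card C"
proof -
  obtain h where h: "bij_betw h C {0..<card C}"
    using ex_bij_betw_finite_nat[OF \<open>finite C\<close>] by blast
  have fC: "f v \<in> C" if "v \<in> V" for v
    using assms(2) that by blast
  have "(h \<circ> f) v < card C" if "v \<in> V" for v
    using bij_betwE[OF h] fC[OF that] by auto
  moreover have "(h \<circ> f) u \<noteq> (h \<circ> f) v" if "u \<in> V" "v \<in> V" "E u v" for u v
    using proper[OF that] inj_onD[OF bij_betw_imp_inj_on[OF h] _ fC fC] that by auto
  ultimately have "proper_colouring V E (card C) (h \<circ> f)"
    unfolding proper_colouring_def by blast
  then show ?thesis
    unfolding chromatic_number_def by (auto intro: Least_le)
qed

text \<open>Vertices are added one at a time: the neighbours of a new vertex use at most
  \<open>d\<close> of the \<open>d + 1\<close> colours. Loops are tolerated, hence the clause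
  \<open>u \<noteq> v\<close>; they do occur later, since the relation z + z' + (x - x')^2 = 0
  relates a pair with z = 0 to itself.\<close>

lemma greedy_colouring:
  fixes E :: "'v \<Rightarrow> 'v \<Rightarrow> bool"
  assumes "finite V"
    and sym: "\<And>u v. E u v \<Longrightarrow> E v u"
    and deg: "\<And>v. v \<in> V \<Longrightarrow> card {u \<in> V. E v u} \<le> d"
  shows "\<exists>f::'v \<Rightarrow> nat. (\<forall>v\<in>V. f v \<le> d) \<and> (\<forall>u\<in>V. \<forall>v\<in>V. u \<noteq> v \<longrightarrow> E u v \<longrightarrow> f u \<noteq> f v)"
  using assms(1) deg
proof (induction V rule: finite_induct)
  case empty
  then show ?case by simp
next
  case (insert v V)
  have "card {u \<in> V. E w u} \<le> d" if "w \<in> V" for w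
  proof -
    have "card {u \<in> V. E w u} \<le> card {u \<in> insert v V. E w u}"
      using insert.hyps(1) by (intro card_mono) auto
    then show ?thesis
      using insert.prems[of w] that by simp
  qed
  then obtain f :: "'v \<Rightarrow> nat" where f: "\<forall>v\<in>V. f v \<le> d"
      "\<forall>u\<in>V. \<forall>v\<in>V. u \<noteq> v \<longrightarrow> E u v \<longrightarrow> f u \<noteq> f v"
    using insert.IH by blast
  let ?N = "{u \<in> V. E v u}"
  have "card ?N \<le> card {u \<in> insert v V. E v u}"
    using insert.hyps(1) by (intro card_mono) auto
  also have "\<dots> \<le> d"
    using insert.prems by simp
  finally have "card (f ` ?N) < card {..d}"
    using card_image_le[of ?N f] insert.hyps(1) by simp
  then have "\<not> {..d} \<subseteq> f ` ?N"
    using card_mono[of "f ` ?N" "{..d}"] insert.hyps(1) by auto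
  then obtain c where c: "c \<le> d" "c \<notin> f ` ?N"
    by auto
  have "(f(v := c)) u \<le> d" if "u \<in> insert v V" for u
    using that f(1) c(1) by auto
  moreover have "(f(v := c)) u \<noteq> (f(v := c)) w"
    if "u \<in> insert v V" "w \<in> insert v V" "u \<noteq> w" "E u w" for u w
    using that f(2) c(2) sym[OF that(4)] by (auto simp: image_iff)
  ultimately show ?case
    by blast
qed

section \<open>Squares in finite fields\<close>

lemma card_square_vimage_le:
  fixes W :: "'a::{field,finite} set"
  shows "card {u. u\<^sup>2 \<in> W} \<le> 2 * card W"
proof -
  have "card {u::'a. u\<^sup>2 = w} \<le> 2" for w
  proof -
    have "{u::'a. u\<^sup>2 = w} = {u. poly [:-w, 0, 1:] u = 0}"
      by (auto simp: power2_eq_square algebra_simps)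
    then show ?thesis
      using card_poly_roots_bound[of "[:-w, 0, 1:]"] by simp
  qed
  then have "card (\<Union>w\<in>W. {u. u\<^sup>2 = w}) \<le> (\<Sum>w\<in>W. 2)"
    by (intro order.trans[OF card_UN_le] sum_mono) auto
  moreover have "(\<Union>w\<in>W. {u. u\<^sup>2 = w}) = {u. u\<^sup>2 \<in> W}"
    by auto
  ultimately show ?thesis by simp
qed

text \<open>Pigeonhole: squaring is at most two-to-one and the field has odd order, so the squares
  fill more than half of it. The set \<open>S\<close> of squares therefore meets its reflection -1 -
  \<open>S\<close>.\<close>

lemma minus_one_sum_two_squares:
  assumes "odd (card (UNIV :: 'a::{field,finite} set))"
  obtains a b :: "'a::{field,finite}" where "a\<^sup>2 + b\<^sup>2 = -1"
proof -
  define S :: "'a set" where "S = range (\<lambda>u. u\<^sup>2)"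
  let ?S' = "(\<lambda>s. -1 - s) ` S"
  have "card (UNIV :: 'a set) \<le> 2 * card S"
    using card_square_vimage_le[of S] by (simp add: S_def)
  then have *: "card (UNIV :: 'a set) < 2 * card S"
    using assms by (metis dvd_triv_left order_le_less)
  have "card ?S' = card S"
    by (intro card_image) (auto intro: inj_onI)
  have "S \<inter> ?S' \<noteq> {}"
  proof
    assume "S \<inter> ?S' = {}"
    then have "card (S \<union> ?S') = 2 * card S"
      using \<open>card ?S' = card S\<close> by (simp add: card_Un_disjoint)
    moreover have "card (S \<union> ?S') \<le> card (UNIV :: 'a set)"
      by (rule card_mono) auto
    ultimately show False using * by simp
  qed
  then obtain a b :: 'a where "a\<^sup>2 = -1 - b\<^sup>2"
    unfolding S_def by auto
  then show ?thesis
    using that[of a b] by (simp add: algebra_simps)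
qed

section \<open>Additive subgroups, their cosets, and an odd sign on a quotient\<close>

definition additive_subgroup :: "'a::ab_group_add set \<Rightarrow> bool" where
  "additive_subgroup A \<longleftrightarrow> 0 \<in> A \<and> (\<forall>x\<in>A. \<forall>y\<in>A. x - y \<in> A)"

definition add_coset :: "'a::ab_group_add set \<Rightarrow> 'a \<Rightarrow> 'a set" where
  "add_coset A x = {y. y - x \<in> A}"

lemma additive_subgroup_uminus: "additive_subgroup A \<Longrightarrow> x \<in> A \<Longrightarrow> - x \<in> A"
  unfolding additive_subgroup_def by (metis diff_0)

lemma additive_subgroup_add: "additive_subgroup A \<Longrightarrow> x \<in> A \<Longrightarrow> y \<in> A \<Longrightarrow> x + y \<in> A"
  using additive_subgroup_uminus[of A y] unfolding additive_subgroup_def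
  by (metis diff_minus_eq_add)

lemma add_coset_eq_iff:
  assumes "additive_subgroup A"
  shows "add_coset A x = add_coset A y \<longleftrightarrow> x - y \<in> A"
proof
  assume "add_coset A x = add_coset A y"
  moreover have "x \<in> add_coset A x"
    using assms by (simp add: add_coset_def additive_subgroup_def)
  ultimately show "x - y \<in> A"
    by (simp add: add_coset_def)
next
  assume xy: "x - y \<in> A"
  have "z - x \<in> A \<longleftrightarrow> z - y \<in> A" for z
  proof
    assume "z - x \<in> A"
    then show "z - y \<in> A"
      using additive_subgroup_add[OF assms _ xy, of "z - x"] by simp
  next
    assume "z - y \<in> A"
    then have "(z - y) - (x - y) \<in> A"
      using assms xy unfolding additive_subgroup_def by blast
    then show "z - x \<in> A" by simp
  qed
  then show "add_coset A x = add_coset A y"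
    by (simp add: add_coset_def)
qed

text \<open>Lagrange's theorem: the cosets are disjoint translates of \<open>A\<close> that cover
  the group.\<close>

lemma card_add_cosets:
  fixes A :: "'a::{ab_group_add,finite} set"
  assumes "additive_subgroup A"
  shows "card A * card (range (add_coset A)) = card (UNIV :: 'a set)"
proof -
  have self: "x \<in> add_coset A x" for x
    using assms by (simp add: add_coset_def additive_subgroup_def)
  then have "\<Union> (range (add_coset A)) = UNIV" by blast
  moreover have "card c = card A" if c: "c \<in> range (add_coset A)" for c
  proof -
    obtain x where "c = add_coset A x" using c by blast
    moreover have "add_coset A x = (\<lambda>a. x + a) ` A"
    proof (intro equalityI subsetI)
      fix y assume "y \<in> add_coset A x"
      then show "y \<in> (\<lambda>a. x + a) ` A"
        by (intro image_eqI[of _ _ "y - x"]) (simp_all add: add_coset_def)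
    qed (auto simp: add_coset_def)
    ultimately show ?thesis by (simp add: card_image)
  qed
  moreover have "c \<inter> c' = {}" if cc: "c \<in> range (add_coset A)" "c' \<in> range (add_coset A)" "c \<noteq> c'" for c c'
  proof (rule ccontr)
    obtain x y where xy: "c = add_coset A x" "c' = add_coset A y" using cc by blast
    assume "c \<inter> c' \<noteq> {}"
    then obtain z where "z - x \<in> A" "z - y \<in> A"
      using xy by (auto simp: add_coset_def)
    then show False
      using cc(3) xy add_coset_eq_iff[OF assms, of z x] add_coset_eq_iff[OF assms, of z y] by simp
  qed
  ultimately show ?thesis
    using card_partition[of "range (add_coset A)" "card A"] by simp
qed

text \<open>The cosets are numbered by an injection \<open>g\<close>, and the sign of
  \<open>z\<close> records whether the coset of \<open>z\<close> comes before that of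
  \<open>- z\<close>. By \<open>tf\<close> these cosets differ outside \<open>W\<close>, so negation
  reverses the comparison; \<open>z'\<close> lies in the coset of \<open>- z\<close>.\<close>

lemma antisymmetric_sign_mod_subgroup:
  fixes W :: "'a::{ab_group_add,finite} set"
  assumes W: "additive_subgroup W"
    and tf: "\<And>z. z + z \<in> W \<Longrightarrow> z \<in> W"
  obtains \<sigma> :: "'a \<Rightarrow> bool"
    where "\<And>z z'. z \<notin> W \<Longrightarrow> z + z' \<in> W \<Longrightarrow> \<sigma> z \<noteq> \<sigma> z'"
proof -
  obtain g :: "'a set \<Rightarrow> nat" where g: "inj g"
    using finite_imp_inj_to_nat_seg[of "UNIV :: 'a set set"] by auto
  let ?\<sigma> = "\<lambda>z. g (add_coset W z) < g (add_coset W (- z))"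
  have "?\<sigma> z \<noteq> ?\<sigma> z'" if "z \<notin> W" "z + z' \<in> W" for z z'
  proof -
    have "add_coset W (- z) = add_coset W z'"
      using additive_subgroup_uminus[OF W that(2)] by (simp add: add_coset_eq_iff[OF W])
    moreover have "add_coset W z = add_coset W (- z')"
      using that(2) by (simp add: add_coset_eq_iff[OF W])
    moreover have "add_coset W z \<noteq> add_coset W (- z)"
      using contrapos_nn[OF that(1) tf] by (simp add: add_coset_eq_iff[OF W])
    then have "g (add_coset W z) \<noteq> g (add_coset W (- z))"
      using g by (simp add: inj_eq)
    ultimately show ?thesis by (simp add: linorder_neq_iff) linarith
  qed
  then show ?thesis by (rule that[of ?\<sigma>])
qed

section \<open>Polynomials with coefficients in a subring, and the construction of \<open>A\<close>
  and \<open>W\<close>\<close>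

definition polys_below :: "'a::comm_ring_1 set \<Rightarrow> nat \<Rightarrow> 'a poly set" where
  "polys_below K n = {f. (\<forall>i. coeff f i \<in> K) \<and> (\<forall>i\<ge>n. coeff f i = 0)}"

text \<open>Induction splits off the constant coefficient. As coefficients must vanish from index
  \<open>n\<close> on, the case \<open>n = 0\<close> leaves only the zero polynomial, which a bound
  on \<open>degree\<close> could not express.\<close>

lemma card_polys_below:
  fixes K :: "'a::comm_ring_1 set"
  assumes "finite K" "0 \<in> K"
  shows "finite (polys_below K n) \<and> card (polys_below K n) = card K ^ n"
proof (induction n)
  case 0
  have "polys_below K 0 = {0}"
    using assms by (simp add: polys_below_def poly_eq_iff set_eq_iff) auto
  then show ?case by simp
next
  case (Suc n)
  have "polys_below K (Suc n) = (\<lambda>(c, f). pCons c f) ` (K \<times> polys_below K n)"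
  proof (intro equalityI subsetI)
    fix f assume f: "f \<in> polys_below K (Suc n)"
    obtain c g where cg: "f = pCons c g" by (rule pCons_cases)
    have "coeff f 0 \<in> K" "coeff f (Suc i) \<in> K" "i \<ge> n \<Longrightarrow> coeff f (Suc i) = 0" for i
      using f by (auto simp: polys_below_def)
    then have "c \<in> K" "g \<in> polys_below K n"
      using cg by (auto simp: polys_below_def)
    then show "f \<in> (\<lambda>(c, f). pCons c f) ` (K \<times> polys_below K n)"
      using cg by auto
  next
    fix f assume "f \<in> (\<lambda>(c, f). pCons c f) ` (K \<times> polys_below K n)"
    then show "f \<in> polys_below K (Suc n)"
      by (auto simp: polys_below_def coeff_pCons split: nat.split)
  qed
  moreover have "inj_on (\<lambda>(c, f). pCons c f) (K \<times> polys_below K n)"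
    by (auto simp: inj_on_def)
  ultimately show ?case
    using Suc assms by (simp add: card_image card_cartesian_product)
qed

lemma polys_below_diff:
  assumes "\<And>x y. x \<in> K \<Longrightarrow> y \<in> K \<Longrightarrow> x - y \<in> K" "f \<in> polys_below K n" "g \<in> polys_below K n"
  shows "f - g \<in> polys_below K n"
  using assms by (simp add: polys_below_def)

lemma polys_below_mult:
  assumes "0 \<in> K" and add: "\<And>x y. x \<in> K \<Longrightarrow> y \<in> K \<Longrightarrow> x + y \<in> K"
    and mult: "\<And>x y. x \<in> K \<Longrightarrow> y \<in> K \<Longrightarrow> x * y \<in> K"
    and f: "f \<in> polys_below K m" and g: "g \<in> polys_below K n"
  shows "f * g \<in> polys_below K (m + n - 1)"
proof -
  have sum: "finite I \<Longrightarrow> (\<And>i. i \<in> I \<Longrightarrow> h i \<in> K) \<Longrightarrow> sum h I \<in> K" for h and I :: "nat set"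
    by (induction I rule: finite_induct) (auto simp: assms(1) add)
  have "coeff (f * g) i \<in> K" for i
    using f g unfolding coeff_mult by (intro sum) (auto simp: polys_below_def mult)
  moreover have "coeff (f * g) i = 0" if "i \<ge> m + n - 1" for i
    unfolding coeff_mult
  proof (intro sum.neutral ballI)
    fix j assume "j \<in> {..i}"
    \<comment> \<open>Otherwise j \<le> m - 1 and i - j \<le> n - 1, which gives i \<le> m + n -
      2.\<close>
    then have "j \<ge> m \<or> i - j \<ge> n"
      using that by auto
    then show "coeff f j * coeff g (i - j) = 0"
      using f g by (auto simp: polys_below_def)
  qed
  ultimately show ?thesis by (simp add: polys_below_def)
qed

text \<open>Union bound: each of the fewer than \<open>card K ^ n\<close> nonzero polynomials has at
  most \<open>n - 1\<close> roots, so these roots cannot exhaust the field. When \<open>K\<close> is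
  a subfield, this makes the first \<open>n\<close> powers of \<theta> independent over
  \<open>K\<close>.\<close>

lemma exists_non_root:
  fixes K :: "'a::{idom,finite} set"
  assumes "0 \<in> K" and "card K ^ n * (n - 1) < card (UNIV :: 'a set)"
  obtains \<theta> :: 'a where "\<And>f. f \<in> polys_below K n \<Longrightarrow> poly f \<theta> = 0 \<Longrightarrow> f = 0"
proof -
  let ?P = "polys_below K n - {0}"
  let ?R = "\<Union>f\<in>?P. {x. poly f x = 0}"
  have fin: "finite (polys_below K n)" and card: "card (polys_below K n) = card K ^ n"
    using card_polys_below[of K n] assms(1) by auto
  have "card {x. poly f x = 0} \<le> n - 1" if f: "f \<in> ?P" for f
  proof -
    have "degree f \<le> n - 1"
      using f by (intro degree_le) (auto simp: polys_below_def)
    then show ?thesis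
      using f card_poly_roots_bound[of f] by auto
  qed
  then have "card ?R \<le> (\<Sum>f\<in>?P. n - 1)"
    using fin by (intro order.trans[OF card_UN_le] sum_mono) auto
  also have "\<dots> \<le> card K ^ n * (n - 1)"
    using card_mono[OF fin, of ?P] card by simp
  also have "\<dots> < card (UNIV :: 'a set)" by fact
  finally have "?R \<noteq> UNIV" by auto
  then show ?thesis using that by auto
qed

text \<open>Translation by 1 permutes the ring, so adding 1 to every element leaves the sum of all
  elements unchanged.\<close>

lemma of_nat_card_UNIV_eq_0: "of_nat (card (UNIV :: 'a::{ring_1,finite} set)) = (0 :: 'a)"
proof -
  have "(\<Sum>x\<in>UNIV. x + 1 :: 'a) = (\<Sum>x\<in>UNIV. x)"
    by (rule sum.reindex_bij_witness[of _ "\<lambda>x. x - 1" "\<lambda>x. x + 1"]) auto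
  then show ?thesis
    by (simp add: sum.distrib)
qed

text \<open>The characteristic is a prime dividing \<open>p ^ N\<close>, so it is \<open>p\<close>,
  and \<open>K\<close> is the image of \<open>of_nat\<close>. Closure under subtraction comes from
  -1 = \<open>of_nat (p - 1)\<close>.\<close>

lemma prime_field_of_finite_field:
  assumes "prime p" "card (UNIV :: 'a::{field,finite} set) = p ^ N"
  obtains K :: "'a::{field,finite} set" where "card K = p" "0 \<in> K" "of_nat p = (0 :: 'a)"
    "\<And>x y. x \<in> K \<Longrightarrow> y \<in> K \<Longrightarrow> x + y \<in> K"
    "\<And>x y. x \<in> K \<Longrightarrow> y \<in> K \<Longrightarrow> x - y \<in> K"
    "\<And>x y. x \<in> K \<Longrightarrow> y \<in> K \<Longrightarrow> x * y \<in> K"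
proof -
  have "prime CHAR('a)"
    by (intro prime_CHAR_semidom finite_imp_CHAR_pos) auto
  moreover have "CHAR('a) dvd p ^ N"
    using of_nat_card_UNIV_eq_0[where 'a = 'a] assms(2) by (simp only: of_nat_eq_0_iff_char_dvd)
  ultimately have char: "CHAR('a) = p"
    using assms(1) by (metis prime_dvd_power primes_dvd_imp_eq)
  have eq: "(of_nat m :: 'a) = of_nat n \<longleftrightarrow> m mod p = n mod p" for m n
    by (simp add: of_nat_eq_iff_cong_CHAR char cong_def)
  have p0: "of_nat p = (0 :: 'a)"
    using of_nat_CHAR[where 'a = 'a] char by simp
  define K :: "'a set" where "K = range of_nat"
  have "K = of_nat ` {..<p}"
  proof -
    have "of_nat n \<in> (of_nat ` {..<p} :: 'a set)" for n
    proof (rule image_eqI)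
      show "(of_nat n :: 'a) = of_nat (n mod p)" by (simp add: eq)
      show "n mod p \<in> {..<p}" using prime_gt_0_nat[OF assms(1)] by simp
    qed
    then show ?thesis unfolding K_def by auto
  qed
  moreover have "inj_on (of_nat :: nat \<Rightarrow> 'a) {..<p}"
    by (auto simp: inj_on_def eq)
  ultimately have "card K = p"
    by (simp add: card_image)
  moreover have "x - y \<in> K" if xy: "x \<in> K" "y \<in> K" for x y
  proof -
    obtain m n where mn: "x = of_nat m" "y = of_nat n"
      using xy K_def by auto
    have "of_nat (p - 1) = (- 1 :: 'a)"
      using p0 prime_ge_1_nat[OF assms(1)] by (simp add: of_nat_diff)
    then have "of_nat ((p - 1) * n) = - (of_nat n :: 'a)"
      by simp
    then have "x - y = of_nat (m + (p - 1) * n)"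
      using mn by (simp del: of_nat_mult)
    then show ?thesis by (simp add: K_def del: of_nat_add)
  qed
  moreover have "0 \<in> K"
    using of_nat_0 unfolding K_def by (metis rangeI)
  moreover have "x + y \<in> K" "x * y \<in> K" if "x \<in> K" "y \<in> K" for x y
    using that unfolding K_def by (auto simp flip: of_nat_add of_nat_mult)
  ultimately show ?thesis
    using that p0 by blast
qed

lemma additive_subgroup_of_nat_mult:
  fixes W :: "'a::ring_1 set"
  assumes "additive_subgroup W" "z \<in> W"
  shows "of_nat n * z \<in> W"
proof (induction n)
  case 0
  then show ?case using assms(1) by (simp add: additive_subgroup_def)
next
  case (Suc n)
  then show ?case
    using additive_subgroup_add[OF assms(1) assms(2), of "of_nat n * z"] by (simp add: algebra_simps)
qed

text \<open>With p = 2h + 1, the integer h + 1 inverts 2 modulo p, so \<open>z\<close> is an integer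
  multiple of \<open>z + z\<close>.\<close>

lemma additive_subgroup_halve:
  fixes W :: "'a::ring_1 set"
  assumes W: "additive_subgroup W" and "odd p" "of_nat p = (0 :: 'a)" "z + z \<in> W"
  shows "z \<in> W"
proof -
  obtain h where h: "p = 2 * h + 1"
    using \<open>odd p\<close> by (rule oddE)
  have "of_nat (h + 1) * (z + z) = of_nat p * z + z"
    by (simp add: h algebra_simps flip: mult_2)
  then have "of_nat (h + 1) * (z + z) = z"
    using assms(3) by simp
  then show ?thesis
    using additive_subgroup_of_nat_mult[OF W assms(4), of "h + 1"] by simp
qed

text \<open>\<open>A\<close> and \<open>W\<close> are the values at \<theta> of the polynomials
  below \<open>n\<close> and below \<open>2 * n - 1\<close>; squaring a polynomial of degree at most
  n - 1 gives degree at most 2n - 2. The condition \<open>3 * n \<le> N + 2\<close> says n + (2n -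
  2) \<le> N, which leaves room for the root count.\<close>

lemma exists_subgroups_squares:
  assumes p: "prime p" "odd p" and card: "card (UNIV :: 'a::{field,finite} set) = p ^ N"
    and n: "n \<ge> 1" "3 * n \<le> N + 2"
  obtains A W :: "'a::{field,finite} set" where "additive_subgroup A" "additive_subgroup W"
    "\<And>a. a \<in> A \<Longrightarrow> a\<^sup>2 \<in> W" "\<And>z. z + z \<in> W \<Longrightarrow> z \<in> W"
    "card A = p ^ n" "card W \<le> p ^ (2 * n - 1)"
proof -
  obtain K :: "'a set" where K: "card K = p" "0 \<in> K" and p0: "of_nat p = (0 :: 'a)"
    and add: "\<And>x y. x \<in> K \<Longrightarrow> y \<in> K \<Longrightarrow> x + y \<in> K"
    and diff: "\<And>x y. x \<in> K \<Longrightarrow> y \<in> K \<Longrightarrow> x - y \<in> K"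
    and mult: "\<And>x y. x \<in> K \<Longrightarrow> y \<in> K \<Longrightarrow> x * y \<in> K"
    using prime_field_of_finite_field[OF p(1) card] by metis
  have "n - 1 < p ^ (n - 1)"
    using prime_ge_2_nat[OF p(1)] by (intro power_gt_expt) auto
  also have "\<dots> \<le> p ^ (2 * n - 2)"
    using prime_ge_1_nat[OF p(1)] by (intro power_increasing) auto
  finally have "p ^ n * (n - 1) < p ^ n * p ^ (2 * n - 2)"
    using prime_gt_0_nat[OF p(1)] by simp
  also have "\<dots> = p ^ (n + (2 * n - 2))"
    by (simp add: power_add)
  also have "\<dots> \<le> p ^ N"
    using prime_ge_1_nat[OF p(1)] n by (intro power_increasing) auto
  finally have "card K ^ n * (n - 1) < card (UNIV :: 'a set)"
    using K card by simp
  then obtain \<theta> :: 'a where \<theta>: "\<And>f. f \<in> polys_below K n \<Longrightarrow> poly f \<theta> = 0 \<Longrightarrow> f = 0"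
    using exists_non_root K(2) by blast
  define V where "V m = (\<lambda>f. poly f \<theta>) ` polys_below K m" for m
  have fin: "finite (polys_below K m)" and card_polys: "card (polys_below K m) = p ^ m" for m
    using card_polys_below[of K m] K by auto
  have sub: "additive_subgroup (V m)" for m
  proof -
    have "0 \<in> polys_below K m"
      using K by (simp add: polys_below_def)
    then have "0 \<in> V m"
      unfolding V_def by (metis imageI poly_0)
    moreover have "x - y \<in> V m" if "x \<in> V m" "y \<in> V m" for x y
      using that polys_below_diff[OF diff] unfolding V_def by (auto simp flip: poly_diff)
    ultimately show ?thesis by (simp add: additive_subgroup_def)
  qed
  have "inj_on (\<lambda>f. poly f \<theta>) (polys_below K n)"
  proof (rule inj_onI)
    fix f g assume "f \<in> polys_below K n" "g \<in> polys_below K n" "poly f \<theta> = poly g \<theta>"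
    then show "f = g"
      using \<theta>[of "f - g"] polys_below_diff[OF diff] by auto
  qed
  then have "card (V n) = p ^ n"
    by (simp add: V_def card_image card_polys)
  \<comment> \<open>Evaluation at \<theta> is known to be injective only below \<open>n\<close>, so
    here only an upper bound is available.\<close>
  moreover have "card (V (2 * n - 1)) \<le> p ^ (2 * n - 1)"
    unfolding V_def using card_image_le[OF fin] card_polys by metis
  moreover have "a\<^sup>2 \<in> V (2 * n - 1)" if "a \<in> V n" for a
  proof -
    obtain f where f: "f \<in> polys_below K n" "a = poly f \<theta>"
      using \<open>a \<in> V n\<close> V_def by auto
    have "f * f \<in> polys_below K (2 * n - 1)"
      using polys_below_mult[OF K(2) add mult f(1) f(1)] by (simp add: mult_2)
    then show ?thesis
      unfolding V_def f(2) power2_eq_square poly_mult[symmetric] by blast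
  qed
  moreover have "z \<in> V (2 * n - 1)" if "z + z \<in> V (2 * n - 1)" for z
    using additive_subgroup_halve[OF sub p(2) p0 that] .
  ultimately show ?thesis
    using that sub by blast
qed

section \<open>Affine coordinates on the projective plane and the colouring\<close>

lemma chi_ER_le:
  fixes A W :: "'a::{field,finite} set"
  assumes odd: "odd (card (UNIV :: 'a set))" and two: "(2 :: 'a) \<noteq> 0"
    and A: "additive_subgroup A" and W: "additive_subgroup W"
    and sq: "\<And>a. a \<in> A \<Longrightarrow> a\<^sup>2 \<in> W" and halve: "\<And>z. z + z \<in> W \<Longrightarrow> z \<in> W"
  shows "chi_ER TYPE('a) \<le> 2 * card (range (add_coset A)) + 2 * card W + 2"
proof -
  obtain a b :: 'a where ab: "a\<^sup>2 + b\<^sup>2 = -1"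
    using minus_one_sum_two_squares[OF odd] .
  define rep :: "('a \<times> 'a \<times> 'a) set \<Rightarrow> 'a \<times> 'a \<times> 'a" where "rep P = (SOME v. v \<in> P)" for P
  define T :: "'a \<times> 'a \<times> 'a \<Rightarrow> 'a" where "T = (\<lambda>(v0, v1, v2). a * v0 + b * v1 + v2)"
  define S :: "'a \<times> 'a \<times> 'a \<Rightarrow> 'a" where "S = (\<lambda>(v0, v1, v2). a * v0 + b * v1 - v2)"
  define R :: "'a \<times> 'a \<times> 'a \<Rightarrow> 'a" where "R = (\<lambda>(v0, v1, v2). a * v1 - b * v0)"
  define dot :: "'a \<times> 'a \<times> 'a \<Rightarrow> 'a \<times> 'a \<times> 'a \<Rightarrow> 'a"
    where "dot = (\<lambda>(x0, x1, x2) (y0, y1, y2). x0 * y0 + x1 * y1 + x2 * y2)"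
  define scale :: "'a \<Rightarrow> 'a \<times> 'a \<times> 'a \<Rightarrow> 'a \<times> 'a \<times> 'a"
    where "scale = (\<lambda>c (x0, x1, x2). (c * x0, c * x1, c * x2))"

  \<comment> \<open>\<open>T\<close> and \<open>S\<close> pair with the isotropic vectors \<open>(a, b, 1)\<close> and \<open>(a, b, -1)\<close>, and \<open>R\<close> with \<open>(-b, a, 0)\<close>,
     which is orthogonal to both.\<close>
  have dot: "2 * dot v w = - (T v * S w + S v * T w + 2 * (R v * R w))" for v w
  proof -
    obtain v0 v1 v2 w0 w1 w2 where vw: "v = (v0, v1, v2)" "w = (w0, w1, w2)"
      by (metis prod_cases3)
    \<comment> \<open>Lagrange's identity: (a v0 + b v1)(a w0 + b w1) + (a v1 - b v0)(a w1 - b w0) =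
      (a^2 + b^2)(v0 w0 + v1 w1).\<close>
    have "- (T v * S w + S v * T w + 2 * (R v * R w))
        = - 2 * (a\<^sup>2 + b\<^sup>2) * (v0 * w0 + v1 * w1) + 2 * (v2 * w2)"
      by (simp add: T_def S_def R_def vw power2_eq_square algebra_simps)
    also have "\<dots> = 2 * dot v w"
      by (simp only: ab) (simp add: dot_def vw algebra_simps)
    finally show ?thesis by simp
  qed
  \<comment> \<open>The linear forms \<open>T\<close>, \<open>S\<close>, \<open>R\<close> together
    determine a vector, because 2 and a^2 + b^2 = -1 are invertible.\<close>
  have coords: "v = scale c w" if "T v = c * T w" "S v = c * S w" "R v = c * R w" for v w c
  proof -
    obtain v0 v1 v2 w0 w1 w2 where vw: "v = (v0, v1, v2)" "w = (w0, w1, w2)"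
      by (metis prod_cases3)
    define d0 d1 d2 where d: "d0 = v0 - c * w0" "d1 = v1 - c * w1" "d2 = v2 - c * w2"
    have T0: "a * d0 + b * d1 + d2 = 0" and S0: "a * d0 + b * d1 - d2 = 0" and R0: "a * d1 - b * d0 = 0"
      using that by (simp_all add: T_def S_def R_def vw d algebra_simps)
    have "2 * d2 = (a * d0 + b * d1 + d2) - (a * d0 + b * d1 - d2)"
      by (simp add: algebra_simps)
    then have d2: "d2 = 0"
      using T0 S0 two by simp
    then have ab0: "a * d0 + b * d1 = 0"
      using T0 by simp
    have "(a\<^sup>2 + b\<^sup>2) * d0 = a * (a * d0 + b * d1) - b * (a * d1 - b * d0)"
      "(a\<^sup>2 + b\<^sup>2) * d1 = b * (a * d0 + b * d1) + a * (a * d1 - b * d0)"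
      by (simp_all add: power2_eq_square algebra_simps)
    then have "d0 = 0" "d1 = 0"
      unfolding ab ab0 R0 by simp_all
    then show ?thesis
      using d2 by (simp add: d scale_def vw)
  qed
  have point: "\<exists>w. w \<noteq> (0, 0, 0) \<and> P = {scale c w | c. c \<noteq> 0}" if P: "P \<in> proj_points" for P
  proof -
    obtain x y z where "P = {(c * x, c * y, c * z) | c. c \<noteq> 0}" "(x, y, z) \<noteq> (0, 0, 0)"
      using P unfolding proj_points_def by blast
    then show ?thesis
      by (intro exI[of _ "(x, y, z)"]) (simp add: scale_def)
  qed
  have scale_scale: "scale c (scale d w) = scale (c * d) w" for c d w
    by (cases w) (simp add: scale_def mult.assoc)
  have scale_1: "scale 1 w = w" for w
    by (cases w) (simp add: scale_def)
  have rep: "P = {scale c (rep P) | c. c \<noteq> 0}" "rep P \<noteq> (0, 0, 0)" if P: "P \<in> proj_points" for P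
  proof -
    obtain w where w: "w \<noteq> (0, 0, 0)" "P = {scale c w | c. c \<noteq> 0}"
      using point[OF P] by blast
    then have "scale 1 w \<in> P" by auto
    then have "rep P \<in> P"
      unfolding rep_def by (rule someI)
    then obtain d where d: "d \<noteq> 0" "rep P = scale d w"
      using w(2) by auto
    have w': "w = scale (1 / d) (rep P)"
      using d by (simp add: scale_scale scale_1)
    have "{scale c w | c. c \<noteq> 0} = {scale c (rep P) | c. c \<noteq> 0}"
    proof (intro equalityI subsetI)
      fix v assume "v \<in> {scale c w | c. c \<noteq> 0}"
      then obtain c where c: "c \<noteq> 0" "v = scale c w" by blast
      have "v = scale (c / d) (rep P)"
        unfolding c(2) by (subst w') (simp add: scale_scale)
      moreover have "c / d \<noteq> 0" using c(1) d(1) by simp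
      ultimately show "v \<in> {scale c (rep P) | c. c \<noteq> 0}" by blast
    next
      fix v assume "v \<in> {scale c (rep P) | c. c \<noteq> 0}"
      then obtain c where c: "c \<noteq> 0" "v = scale c (rep P)" by blast
      then have "v = scale (c * d) w" "c * d \<noteq> 0"
        using d by (simp_all add: scale_scale)
      then show "v \<in> {scale c w | c. c \<noteq> 0}" by blast
    qed
    with w(2) show "P = {scale c (rep P) | c. c \<noteq> 0}"
      by (rule trans)
    show "rep P \<noteq> (0, 0, 0)"
      using w(1) d by (cases w) (auto simp: scale_def)
  qed
  have dot_scale: "dot (scale c v) (scale d w) = c * d * dot v w" for c d v w
    by (cases v; cases w) (simp add: dot_def scale_def algebra_simps)
  have adj: "P \<noteq> P' \<and> dot (rep P) (rep P') = 0"
    if P: "P \<in> proj_points" "P' \<in> proj_points" "er_adj P P'" for P P'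
  proof -
    obtain x0 x1 x2 y0 y1 y2 where xy: "(x0, x1, x2) \<in> P" "(y0, y1, y2) \<in> P'"
      "x0 * y0 + x1 * y1 + x2 * y2 = 0" and ne: "P \<noteq> P'"
      using P(3) unfolding er_adj_def by blast
    define u v where "u = (x0, x1, x2)" "v = (y0, y1, y2)"
    then have uv: "u \<in> P" "v \<in> P'" "dot u v = 0"
      using xy by (simp_all add: dot_def)
    obtain c d where "c \<noteq> 0" "d \<noteq> 0" "u = scale c (rep P)" "v = scale d (rep P')"
      using uv rep(1)[OF P(1)] rep(1)[OF P(2)] by blast
    then show ?thesis
      using uv(3) ne by (simp add: dot_scale)
  qed
  have same: "P = P'" if P: "P \<in> proj_points" "P' \<in> proj_points" "rep P = scale c (rep P')" "c \<noteq> 0" for P P' c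
  proof -
    have sub: "P \<subseteq> P'" if P: "P \<in> proj_points" "P' \<in> proj_points" "rep P = scale c (rep P')" "c \<noteq> 0" for P P' c
    proof
      fix v assume "v \<in> P"
      then obtain e where e: "e \<noteq> 0" "v = scale e (rep P)"
        using rep(1)[OF P(1)] by blast
      then have "v = scale (e * c) (rep P')" "e * c \<noteq> 0"
        using P(3,4) by (simp_all add: scale_scale)
      then show "v \<in> P'"
        using rep(1)[OF P(2)] by blast
    qed
    have "rep P' = scale (1 / c) (rep P)"
      using P(3,4) by (simp add: scale_scale scale_1)
    then show ?thesis
      using sub[OF P] sub[OF P(2,1), of "1 / c"] P(4) by simp
  qed

  \<comment> \<open>Normalising \<open>T\<close> to 1 and writing s = S/T, x = R/T, orthogonality
    reads s + s' + 2xx' = 0. The choice z = -(s + x^2) completes the square.\<close>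
  define X where "X P = R (rep P) / T (rep P)" for P
  define Z where "Z P = - (S (rep P) / T (rep P) + (X P)\<^sup>2)" for P
  have affine_adj: "Z P + Z P' + (X P - X P')\<^sup>2 = 0"
    if "dot (rep P) (rep P') = 0" "T (rep P) \<noteq> 0" "T (rep P') \<noteq> 0" for P P'
  proof -
    let ?t = "T (rep P)" and ?t' = "T (rep P')"
    have "Z P + Z P' + (X P - X P')\<^sup>2 = - (S (rep P) / ?t + S (rep P') / ?t' + 2 * (X P * X P'))"
      by (simp add: Z_def power2_eq_square algebra_simps)
    also have "\<dots> = 2 * dot (rep P) (rep P') / (?t * ?t')"
      using that(2,3) unfolding dot X_def by (simp add: field_simps)
    finally show ?thesis using that(1) by simp
  qed
  have affine_inj: "P = P'"
    if P: "P \<in> proj_points" "P' \<in> proj_points" "T (rep P) \<noteq> 0" "T (rep P') \<noteq> 0" "X P = X P'" "Z P = Z P'" for P P'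
  proof -
    let ?c = "T (rep P) / T (rep P')"
    have "S (rep P) / T (rep P) = S (rep P') / T (rep P')"
      using P(5,6) by (simp add: Z_def)
    then have "rep P = scale ?c (rep P')"
      using P(3-5) by (intro coords) (simp_all add: X_def field_simps)
    then show ?thesis
      using same[OF P(1,2)] P(3,4) by simp
  qed

  obtain \<sigma> :: "'a \<Rightarrow> bool" where \<sigma>: "\<And>z z'. z \<notin> W \<Longrightarrow> z + z' \<in> W \<Longrightarrow> \<sigma> z \<noteq> \<sigma> z'"
    using antisymmetric_sign_mod_subgroup[OF W halve] by blast
  define E :: "'a \<times> 'a \<Rightarrow> 'a \<times> 'a \<Rightarrow> bool"
    where "E = (\<lambda>(x, z) (x', z'). z + z' + (x - x')\<^sup>2 = 0)"
  have "\<exists>g :: 'a \<times> 'a \<Rightarrow> nat. (\<forall>v\<in>UNIV \<times> W. g v \<le> 2 * card W) \<and>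
      (\<forall>u\<in>UNIV \<times> W. \<forall>v\<in>UNIV \<times> W. u \<noteq> v \<longrightarrow> E u v \<longrightarrow> g u \<noteq> g v)"
  proof (rule greedy_colouring)
    show "E v u" if "E u v" for u v
      using that by (auto simp: E_def add.commute power2_commute)
    show "card {u \<in> UNIV \<times> W. E v u} \<le> 2 * card W" if "v \<in> UNIV \<times> W" for v
    proof -
      obtain x z where v: "v = (x, z)" "z \<in> W"
        using \<open>v \<in> UNIV \<times> W\<close> by auto
      \<comment> \<open>A neighbour is determined by t = x - x', since z' = -z - t^2, and t^2 = -(z
        + z') lies in \<open>W\<close>.\<close>
      have "{u \<in> UNIV \<times> W. E v u} \<subseteq> (\<lambda>t. (x - t, - z - t\<^sup>2)) ` {t. t\<^sup>2 \<in> W}"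
      proof
        fix u assume "u \<in> {u \<in> UNIV \<times> W. E v u}"
        then obtain x' z' where u: "u = (x', z')" "z' \<in> W" "z + z' + (x - x')\<^sup>2 = 0"
          by (auto simp: E_def v)
        have "(x - x')\<^sup>2 = - (z + z')"
          using u(3) by (metis add_eq_0_iff)
        moreover have "- (z + z') \<in> W"
          using additive_subgroup_uminus[OF W] additive_subgroup_add[OF W v(2) u(2)] .
        ultimately show "u \<in> (\<lambda>t. (x - t, - z - t\<^sup>2)) ` {t. t\<^sup>2 \<in> W}"
          unfolding u(1) by (intro image_eqI[of _ _ "x - x'"]) auto
      qed
      then have "card {u \<in> UNIV \<times> W. E v u} \<le> card {t. t\<^sup>2 \<in> W}"
        by (intro surj_card_le) auto
      then show ?thesis
        using card_square_vimage_le[of W] by simp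
    qed
  qed auto
  then obtain g :: "'a \<times> 'a \<Rightarrow> nat" where g: "\<And>v. v \<in> UNIV \<times> W \<Longrightarrow> g v \<le> 2 * card W"
      "\<And>u v. u \<in> UNIV \<times> W \<Longrightarrow> v \<in> UNIV \<times> W \<Longrightarrow> u \<noteq> v \<Longrightarrow> E u v \<Longrightarrow> g u \<noteq> g v"
    by metis

  \<comment> \<open>The values of \<open>g\<close> are at most \<open>2 * card W\<close>, so
    \<open>2 * card W + 1\<close> is a fresh colour for the points with T = 0, R \<noteq> 0, which
    are pairwise non-orthogonal. The single point with T = R = 0 may reuse colour 0: its neighbours
    all satisfy T = 0.\<close>
  define f :: "('a \<times> 'a \<times> 'a) set \<Rightarrow> 'a set \<times> bool + nat" where
    "f P = (if T (rep P) = 0 then Inr (if R (rep P) = 0 then 0 else 2 * card W + 1)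
            else if Z P \<in> W then Inr (g (X P, Z P))
            else Inl (add_coset A (X P), \<sigma> (Z P)))" for P
  define C :: "('a set \<times> bool + nat) set" where
    "C = (range (add_coset A) \<times> UNIV) <+> {..2 * card W + 1}"
  have fC: "f ` proj_points \<subseteq> C"
    using g(1) by (force simp: f_def C_def intro: le_SucI)
  \<comment> \<open>With c = 0, \<open>coords\<close> shows that a vector on which all three forms
    vanish is zero.\<close>
  have infinity: "S (rep P) \<noteq> 0" if "P \<in> proj_points" "T (rep P) = 0" "R (rep P) = 0" for P
    using coords[of "rep P" 0 "rep P"] that rep(2)[OF that(1)] by (cases "rep P") (auto simp: scale_def)
  have half: "f P \<noteq> f P'"
    if P: "P \<in> proj_points" "P' \<in> proj_points" "P \<noteq> P'" "dot (rep P) (rep P') = 0" "T (rep P) = 0" for P P'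
  proof -
    have eq: "S (rep P) * T (rep P') + 2 * (R (rep P) * R (rep P')) = 0"
      using dot[of "rep P" "rep P'"] unfolding P(4,5)
      by (metis add_0 mult_zero_left mult_zero_right neg_equal_0_iff_equal)
    show ?thesis
    proof (cases "T (rep P') = 0")
      case True
      then have "R (rep P) = 0 \<or> R (rep P') = 0"
        using eq two by simp
      moreover have "\<not> (R (rep P) = 0 \<and> R (rep P') = 0)"
      proof
        assume RR: "R (rep P) = 0 \<and> R (rep P') = 0"
        have s: "S (rep P) \<noteq> 0" "S (rep P') \<noteq> 0"
          using infinity P True RR by blast+
        then have "rep P = scale (S (rep P) / S (rep P')) (rep P')"
          using P(5) True RR by (intro coords) auto
        moreover have "S (rep P) / S (rep P') \<noteq> 0"
          using s by simp
        ultimately show False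
          using same[OF P(1,2)] P(3) by blast
      qed
      ultimately show ?thesis
        using P(5) True by (auto simp: f_def)
    next
      case False
      then have "R (rep P) \<noteq> 0"
        using eq infinity[OF P(1,5)] by auto
      then show ?thesis
        using P(5) False g(1)[of "(X P', Z P')"] by (auto simp: f_def)
    qed
  qed
  have "f P \<noteq> f P'"
    if P: "P \<in> proj_points" "P' \<in> proj_points" "er_adj P P'" for P P'
  proof -
    have ne: "P \<noteq> P'" and dot0: "dot (rep P) (rep P') = 0"
      using adj[OF P] by auto
    have dot0': "dot (rep P') (rep P) = 0"
      using dot0 by (simp add: dot_def case_prod_unfold mult.commute)
    consider "T (rep P) = 0" | "T (rep P') = 0" | "T (rep P) \<noteq> 0" "T (rep P') \<noteq> 0"
      by blast
    then show ?thesis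
    proof cases
      case 1
      then show ?thesis using half[OF P(1,2) ne dot0] by simp
    next
      case 2
      then show ?thesis using half[OF P(2,1) ne[symmetric] dot0'] by simp
    next
      case 3
      have zz: "Z P + Z P' + (X P - X P')\<^sup>2 = 0"
        using affine_adj[OF dot0 3] .
      \<comment> \<open>\<open>g\<close> separates only distinct related pairs, so distinct points
        must have distinct coordinates.\<close>
      have ne': "(X P, Z P) \<noteq> (X P', Z P')"
        using affine_inj[OF P(1,2) 3] ne by auto
      show ?thesis
      proof (cases "Z P \<in> W \<and> Z P' \<in> W")
        case True
        then show ?thesis
          using 3 g(2)[of "(X P, Z P)" "(X P', Z P')"] zz ne' by (simp add: f_def E_def)
      next
        case False
        show ?thesis
        proof
          assume eq: "f P = f P'"
          \<comment> \<open>Equal colours carry the same tag \<open>Inl\<close> or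
            \<open>Inr\<close>; as \<open>Z P\<close> and \<open>Z P'\<close> are not both in
            \<open>W\<close>, neither is.\<close>
          then have "Z P \<notin> W" "add_coset A (X P) = add_coset A (X P')" "\<sigma> (Z P) = \<sigma> (Z P')"
            using False 3 by (auto simp: f_def split: if_splits)
          moreover from this have "(X P - X P')\<^sup>2 \<in> W"
            using sq by (simp add: add_coset_eq_iff[OF A])
          then have "- (X P - X P')\<^sup>2 \<in> W"
            by (rule additive_subgroup_uminus[OF W])
          then have "Z P + Z P' \<in> W"
            using zz by (metis eq_neg_iff_add_eq_0)
          ultimately show False
            using \<sigma> by blast
        qed
      qed
    qed
  qed
  then have "chromatic_number (proj_points :: ('a \<times> 'a \<times> 'a) set set) er_adj \<le> card C"
    using fC by (intro chromatic_number_le_card_colours) (auto simp: C_def)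
  also have "card C = 2 * card (range (add_coset A)) + 2 * card W + 2"
    by (simp add: C_def card_Plus card_cartesian_product)
  finally show ?thesis
    by (simp add: chi_ER_def)
qed

section \<open>Numerical estimate of the number of colours\<close>

lemma colour_count_le_powr:
  fixes p N n :: nat
  assumes "p \<ge> 3" "n \<ge> 1" "N \<le> 3 * n" "3 * n \<le> N + 2"
  shows "2 * real p ^ (N - n) + 2 * real p ^ (2 * n - 1) \<le> 8 / 3 * real p powr ((2 * real N + 1) / 3)"
proof -
  obtain m where n: "n = Suc m"
    using assms(2) by (cases n) auto
  have p: "real p \<ge> 3" using assms(1) by simp
  have powr: "real p ^ j \<le> real p powr x" if "real j \<le> x" for j x
    using powr_mono[OF that, of "real p"] p by (simp add: powr_realpow)
  \<comment> \<open>The exponents N - n and 2n - 1 are respectively 2n and 2n - 1, both 2n - 1, or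
    2n - 2 and 2n - 1. When they differ by one, p \<ge> 3 gives the factor 2(1 + 1/3) = 8/3.\<close>
  consider "N = 3 * n" | "N = 3 * n - 1" | "N = 3 * n - 2"
    using assms by linarith
  then show ?thesis
  proof cases
    case 1
    have "2 * real p ^ (N - n) + 2 * real p ^ (2 * n - 1) = 2 * real p ^ (2 * n) + 2 * real p ^ (2 * n - 1)"
      using 1 by simp
    also have "3 * real p ^ (2 * n - 1) \<le> real p ^ (2 * n)"
      using p by (simp add: n mult_right_mono)
    then have "2 * real p ^ (2 * n) + 2 * real p ^ (2 * n - 1) \<le> 8 / 3 * real p ^ (2 * n)"
      by simp
    also have "\<dots> \<le> 8 / 3 * real p powr ((2 * real N + 1) / 3)"
      using 1 by (intro mult_left_mono powr) auto
    finally show ?thesis .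
  next
    case 2
    \<comment> \<open>Here the target exponent exceeds 2n - 1 by 2/3, and 2 \<le> p^(2/3) because 8
      < 9 \<le> p^2.\<close>
    have "(2::real) = 8 powr (1 / 3)"
      using powr_powr[of 2 3 "1/3"] by simp
    also have "\<dots> \<le> (real p ^ 2) powr (1 / 3)"
      using power_mono[OF p, of 2] by (intro powr_mono2) auto
    also have "\<dots> = real p powr (2 / 3)"
      using p powr_powr[of "real p" 2 "1/3"] by simp
    finally have "2 * real p ^ (2 * n - 1) \<le> real p powr (2 / 3) * real p ^ (2 * n - 1)"
      by (intro mult_right_mono) auto
    also have "\<dots> = real p powr (2 / 3 + real (2 * n - 1))"
      using p by (simp add: powr_add powr_realpow)
    also have "2 / 3 + real (2 * n - 1) = (2 * real N + 1) / 3"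
      using 2 by (simp add: n)
    finally have "2 * real p ^ (2 * n - 1) \<le> real p powr ((2 * real N + 1) / 3)" .
    moreover have e: "N - n = 2 * n - 1"
      using 2 by simp
    moreover have "0 \<le> real p powr ((2 * real N + 1) / 3)"
      by simp
    ultimately show ?thesis
      unfolding e by linarith
  next
    case 3
    have "real p ^ (2 * n - 1) = real p * real p ^ (N - n)"
      using 3 by (simp add: n)
    then have "3 * real p ^ (N - n) \<le> real p ^ (2 * n - 1)"
      using p by (simp add: mult_right_mono)
    then have "2 * real p ^ (N - n) + 2 * real p ^ (2 * n - 1) \<le> 8 / 3 * real p ^ (2 * n - 1)"
      by simp
    also have "\<dots> \<le> 8 / 3 * real p powr ((2 * real N + 1) / 3)"
      using 3 by (intro mult_left_mono powr) (auto simp: n)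
    finally show ?thesis .
  qed
qed

section \<open>The choice of \<open>n\<close> and the final comparison\<close>

theorem theorem1p2:
  fixes q r :: nat
  assumes "\<exists>p k. prime p \<and> odd p \<and> odd k \<and> q = p ^ k"
    and "r \<ge> 1"
    and "card (UNIV :: 'a::{field,finite} set) = q"
    and "card (UNIV :: 'b::{field,finite} set) = q ^ (2 * r + 1)"
    and "\<exists>\<mu>::'a. irreducible (monom 1 (2 * r + 1) - [:\<mu>:])"
  shows "real (chi_ER TYPE('b))
           \<le> (2 * real r + 5) / 3 * real q powr (4 * real r / 3 + 1)
             + (2 * real r + 1) * real q ^ (r + 1) + 1"
proof -
  obtain p k where p: "prime p" "odd p" and k: "odd k" and q: "q = p ^ k"
    using assms(1) by blast
  have p3: "p \<ge> 3"
    using p prime_ge_2_nat[OF p(1)] by (cases "p = 2") auto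
  have k1: "k \<ge> 1"
    using k by (cases k) auto
  have q3: "q \<ge> 3"
    using p3 k1 self_le_power[of p k] q by simp
  define N where "N = k * (2 * r + 1)"
  have card: "card (UNIV :: 'b set) = p ^ N"
    using assms(4) by (simp only: q N_def power_mult)
  define n where "n = (N + 2) div 3"
  have "N \<ge> 1" using k1 by (simp add: N_def)
  then have n: "n \<ge> 1" "N \<le> 3 * n" "3 * n \<le> N + 2"
    unfolding n_def by linarith+
  obtain A W :: "'b set" where A: "additive_subgroup A" "card A = p ^ n"
    and W: "additive_subgroup W" "card W \<le> p ^ (2 * n - 1)"
    and sq: "\<And>a. a \<in> A \<Longrightarrow> a\<^sup>2 \<in> W" and halve: "\<And>z. z + z \<in> W \<Longrightarrow> z \<in> W"
    using exists_subgroups_squares[OF p card n(1,3)] by metis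
  have odd: "odd (card (UNIV :: 'b set))"
    using p(2) by (simp add: card)
  have two: "(2 :: 'b) \<noteq> 0"
  proof
    assume "(2 :: 'b) = 0"
    moreover obtain h where "card (UNIV :: 'b set) = 2 * h + 1"
      using odd by (rule oddE)
    ultimately show False
      using of_nat_card_UNIV_eq_0[where 'a = 'b] by simp
  qed
  have "p ^ n * card (range (add_coset A)) = p ^ n * p ^ (N - n)"
    using card_add_cosets[OF A(1)] A(2) card n by (simp flip: power_add)
  then have "card (range (add_coset A)) = p ^ (N - n)"
    using p3 by simp
  then have "chi_ER TYPE('b) \<le> 2 * p ^ (N - n) + 2 * p ^ (2 * n - 1) + 2"
    using chi_ER_le[OF odd two A(1) W(1) sq halve] W(2) by simp
  then have "real (chi_ER TYPE('b)) \<le> real (2 * p ^ (N - n) + 2 * p ^ (2 * n - 1) + 2)"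
    by (simp only: of_nat_le_iff)
  then have chi: "real (chi_ER TYPE('b)) \<le> 2 * real p ^ (N - n) + 2 * real p ^ (2 * n - 1) + 2"
    by simp
  show ?thesis
  \<comment> \<open>For r = 1 the coefficient (2r + 5)/3 = 7/3 is below 8/3. In that case N = 3k and
    n = k, so the count is at most 4q^2 + 2, while the target is at least (7/3 + 3)q^2 + 1.\<close>
  proof (cases "r = 1")
    case True
    then have "n = k" "N - n = k * 2"
      by (auto simp: n_def N_def)
    then have "real p ^ (N - n) = real q ^ 2"
      by (simp only: q power_mult of_nat_power)
    moreover have "real p ^ (2 * n - 1) \<le> real q ^ 2"
    proof -
      have "real p ^ (2 * n - 1) \<le> real p ^ (k * 2)"
        using p3 \<open>n = k\<close> by (intro power_increasing) auto
      then show ?thesis by (simp only: q power_mult of_nat_power)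
    qed
    moreover have "real q ^ 2 \<le> real q powr (4 * real r / 3 + 1)"
      using q3 True powr_mono[of 2 "7/3" "real q"] by simp
    moreover have "real q ^ 2 \<ge> 9"
      using power_mono[of 3 "real q" 2] q3 by simp
    ultimately show ?thesis
      using chi True by (simp add: power2_eq_square)
  next
    case False
    have "2 * real p ^ (N - n) + 2 * real p ^ (2 * n - 1) \<le> 8 / 3 * real p powr ((2 * real N + 1) / 3)"
      by (rule colour_count_le_powr[OF p3 n])
    \<comment> \<open>After substituting N = k(2r + 1) this reduces to 2k + 1 \<le> 3k.\<close>
    also have "(2 * real N + 1) / 3 \<le> real k * (4 * real r / 3 + 1)"
      using k1 by (simp add: N_def field_simps)
    then have "8 / 3 * real p powr ((2 * real N + 1) / 3) \<le> 8 / 3 * real p powr (real k * (4 * real r / 3 + 1))"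
      using p3 by (intro mult_left_mono powr_mono) auto
    also have "\<dots> = 8 / 3 * real q powr (4 * real r / 3 + 1)"
      using p3 by (simp add: q powr_powr powr_realpow flip: powr_powr)
    \<comment> \<open>Now r \<ge> 2, so (2r + 5)/3 \<ge> 3 > 8/3.\<close>
    also have "\<dots> \<le> (2 * real r + 5) / 3 * real q powr (4 * real r / 3 + 1)"
      using False assms(2) by (intro mult_right_mono) auto
    finally have "2 * real p ^ (N - n) + 2 * real p ^ (2 * n - 1)
        \<le> (2 * real r + 5) / 3 * real q powr (4 * real r / 3 + 1)" .
    \<comment> \<open>The count ends in + 2 but the target in + 1; the middle term of the target
      absorbs the difference.\<close>
    moreover have "1 * 1 \<le> (2 * real r + 1) * real q ^ (r + 1)"
      using q3 by (intro mult_mono one_le_power) auto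
    ultimately show ?thesis
      using chi by linarith
  qed
qed

end
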